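(* If $1<r\le n$, then for any $k>2$, $\mathcal{Y}_r\ne\overline{\mathcal{Y}}_r$.
   Context: $\mathsf{S}^k(\mathbb{C}^n)$ is the space of symmetric order-$k$ tensors, i.e. elements of $(\mathbb{C}^n)^{\otimes k}$ invariant under all permutations of the $k$ factors. For $A\in\mathsf{S}^k(\mathbb{C}^n)$, the symmetric rank $\operatorname{rank}_{\mathsf{S}}(A)$ is the least $s\ge0$ such that $A=\sum_{i=1}^s\mathbf{y}_i^{\otimes k}$ with $\mathbf{y}_i\in\mathbb{C}^n$. Put $\mathcal{Y}_r=\{A\in\mathsf{S}^k(\mathbb{C}^n)\mid\operatorname{rank}_{\mathsf{S}}(A)\le r\}$; $\overline{\mathcal{Y}}_r$ denotes its Zariski closure in $\mathsf{S}^k(\mathbb{C}^n)$. *)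

theory Defs
  imports "HOL-Analysis.Analysis" "HOL-Library.Extended_Nat"
begin

text \<open>
  A tensor in the \<open>k\<close>-fold tensor power of \<open>\<complex>\<^sup>n\<close> is given by its coordinates, indexed by
  multi-indices \<open>'k \<Rightarrow> 'n\<close>, where \<open>k = CARD('k)\<close> and \<open>n = CARD('n)\<close>; the elements
  of \<open>'k\<close> name the tensor factors.
\<close>

type_synonym ('k, 'n) tensor = "complex ^ ('k \<Rightarrow> 'n)"

definition sym_tensors :: "('k::finite, 'n::finite) tensor set" where
  "sym_tensors = {A. \<forall>\<pi>. bij \<pi> \<longrightarrow> (\<forall>f. A $ (f \<circ> \<pi>) = A $ f)}"

definition tensor_power :: "complex ^ 'n \<Rightarrow> ('k::finite, 'n::finite) tensor" where
  "tensor_power y = (\<chi> f. \<Prod>j\<in>UNIV. y $ f j)"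

text \<open>
  The infimum in \<^typ>\<open>enat\<close> is a minimum whenever some decomposition exists, and is \<open>\<infinity>\<close>
  otherwise. Every complex symmetric tensor of order at least one has a decomposition.
\<close>

definition sym_rank :: "('k::finite, 'n::finite) tensor \<Rightarrow> enat" where
  "sym_rank A = Inf {enat s | s. \<exists>y :: nat \<Rightarrow> complex ^ 'n. A = (\<Sum>i<s. tensor_power (y i))}"

definition sym_rank_le :: "nat \<Rightarrow> ('k::finite, 'n::finite) tensor set" where
  "sym_rank_le r = {A \<in> sym_tensors. sym_rank A \<le> enat r}"

text \<open>
  These are polynomials over \<open>\<complex>\<close> in the complex coordinates. The \<open>polynomial_function\<close> of
  HOL-Analysis is a different notion: its polynomials are real, so they include complex conjugation.
\<close>

inductive complex_polynomial :: "(complex ^ 'm \<Rightarrow> complex) \<Rightarrow> bool" where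
  const: "complex_polynomial (\<lambda>x. c)"
| coord: "complex_polynomial (\<lambda>x. x $ i)"
| add: "complex_polynomial p \<Longrightarrow> complex_polynomial q \<Longrightarrow> complex_polynomial (\<lambda>x. p x + q x)"
| mult: "complex_polynomial p \<Longrightarrow> complex_polynomial q \<Longrightarrow> complex_polynomial (\<lambda>x. p x * q x)"

text \<open>
  In the following two definitions \<open>V\<close> is a linear subspace of the ambient coordinate space. The
  polynomial functions on \<open>V\<close> are the restrictions of the ambient ones, since every linear
  functional on \<open>V\<close> extends to the whole space.
\<close>

definition zariski_closed_in :: "(complex ^ 'm) set \<Rightarrow> (complex ^ 'm) set \<Rightarrow> bool" where
  "zariski_closed_in V Z \<longleftrightarrow>
     (\<exists>P. (\<forall>p\<in>P. complex_polynomial p) \<and> Z = {x \<in> V. \<forall>p\<in>P. p x = 0})"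

definition zariski_closure_in :: "(complex ^ 'm) set \<Rightarrow> (complex ^ 'm) set \<Rightarrow> (complex ^ 'm) set" where
  "zariski_closure_in V Y = zariski_closed_in V hull Y"

end

theory Submission
  imports Defs
begin

text \<open>
  Write \<open>e\<^sub>i\<close> for the standard basis vectors and \<open>k\<close> for the order of the tensors. Let \<open>J\<close> be a set of
  \<open>r\<close> basis indices containing \<open>a \<noteq> b\<close>, and let \<open>A\<close> be the derivative of \<open>y\<^bsup>\<otimes>k\<^esup>\<close> at \<open>e\<^sub>a\<close> in
  direction \<open>e\<^sub>b\<close>, plus the powers \<open>e\<^sub>i\<^bsup>\<otimes>k\<^esup>\<close> for \<open>i \<in> J - {a, b}\<close>. This tensor lies in the
  Zariski closure of the tensors of symmetric rank at most \<open>r\<close>, but is not itself one of them.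

  The difference quotients \<open>((e\<^sub>a + t e\<^sub>b)\<^bsup>\<otimes>k\<^esup> - e\<^sub>a\<^bsup>\<otimes>k\<^esup>) / t\<close> are sums of two tensor powers, because
  complex scalars have \<open>k\<close>-th roots. So \<open>A\<close> is a limit of tensors of symmetric rank at most
  \<open>r\<close>, and polynomials, being continuous, cannot separate it from them
  (\<open>tangent_plus_powers_in_closure\<close>).

  If \<open>A\<close> were a sum of \<open>r\<close> powers, then adding the missing \<open>e\<^sub>i\<^bsup>\<otimes>k\<^esup>\<close> for \<open>i \<notin> J\<close> would yield a
  sum of \<open>n\<close> powers of vectors \<open>y\<^sub>i\<close>, so one may take \<open>J\<close> to be everything. Fixing all
  indices of \<open>A\<close> but one leaves a vector, a slice of \<open>A\<close>, which is a linear combination of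
  the \<open>y\<^sub>i\<close>. Every \<open>e\<^sub>m\<close> is a slice, so the \<open>n\<close> vectors \<open>y\<^sub>i\<close> are a basis, and a vanishing
  slice has vanishing coefficients (\<open>vanishing_slice\<close>). When \<open>k > 2\<close>, the slice with all fixed indices
  equal to \<open>b\<close> vanishes, because every nonzero entry of the derivative has exactly one index
  \<open>b\<close>. Its coefficients are the powers \<open>(y\<^sub>i)\<^sub>b\<^bsup>k-1\<^esup>\<close>, so all \<open>y\<^sub>i\<close> have \<open>b\<close>-coordinate
  zero, and no entry of \<open>A\<close> with an index \<open>b\<close> can be nonzero, although the derivative has such
  entries (\<open>tangent_plus_powers_not_sum\<close>).
\<close>

section \<open>Sums of tensor powers\<close>

lemma tensor_power_zero: "tensor_power 0 = (0 :: ('k::finite, 'n::finite) tensor)"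
  by (simp add: tensor_power_def vec_eq_iff)

lemma tensor_power_scale:
  "tensor_power (c *s y) = (c ^ CARD('k)) *s (tensor_power y :: ('k::finite, 'n::finite) tensor)"
  by (simp add: tensor_power_def vec_eq_iff prod.distrib)

lemma scaled_tensor_power_is_tensor_power:
  "\<exists>z. tensor_power z = c *s (tensor_power y :: ('k::finite, 'n::finite) tensor)"
proof -
  obtain d where "c = d ^ CARD('k)"
    using exists_complex_root[of "CARD('k)" c] by auto
  then show ?thesis
    by (metis tensor_power_scale)
qed

lemma tensor_power_in_sym_tensors:
  "tensor_power y \<in> (sym_tensors :: ('k::finite, 'n::finite) tensor set)"
proof -
  have "(\<Prod>j\<in>UNIV. y $ f (\<pi> j)) = (\<Prod>j\<in>UNIV. y $ f j)"
    if "bij \<pi>" for \<pi> :: "'k \<Rightarrow> 'k" and f :: "'k \<Rightarrow> 'n"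
    using prod.reindex_bij_betw[OF that, of "\<lambda>j. y $ f j"] .
  then show ?thesis
    by (simp add: sym_tensors_def tensor_power_def)
qed

lemma sum_in_sym_tensors: "(\<And>i. i \<in> I \<Longrightarrow> T i \<in> sym_tensors) \<Longrightarrow> (\<Sum>i\<in>I. T i) \<in> sym_tensors"
  by (auto simp: sym_tensors_def intro!: sum.cong)

lemma sym_rank_le_decomposition:
  assumes "sym_rank A \<le> enat r"
  obtains s y where "s \<le> r" "A = (\<Sum>i<s. tensor_power (y i))"
proof -
  let ?S = "{enat s | s. \<exists>y. A = (\<Sum>i<s. tensor_power (y i))}"
  have "?S \<noteq> {}"
    using assms by (auto simp: sym_rank_def Inf_enat_def split: if_splits)
  then have "Inf ?S \<in> ?S"
    by (meson all_not_in_conv wellorder_InfI)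
  then obtain s y where "Inf ?S = enat s" "A = (\<Sum>i<s. tensor_power (y i))"
    by blast
  with assms that show ?thesis
    by (simp add: sym_rank_def)
qed

text \<open>
  The zero vector contributes the zero tensor, so a decomposition into at most \<open>r\<close> powers can be
  padded to one into exactly \<open>r\<close> powers, indexed by any set of that size.
\<close>

lemma sym_rank_le_iff:
  fixes A :: "('k::finite, 'n::finite) tensor" and J :: "'j set"
  assumes "finite J" and "card J = r"
  shows "A \<in> sym_rank_le r \<longleftrightarrow> (\<exists>y. A = (\<Sum>i\<in>J. tensor_power (y i)))"
proof
  assume "A \<in> sym_rank_le r"
  then obtain s and y :: "nat \<Rightarrow> complex ^ 'n"
    where s: "s \<le> r" and A: "A = (\<Sum>m<s. tensor_power (y m))"
    unfolding sym_rank_le_def by (auto elim: sym_rank_le_decomposition)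
  obtain h where h: "bij_betw h J {..<r}"
    using ex_bij_betw_finite_nat[OF assms(1)] assms(2) by (auto simp: atLeast0LessThan)
  let ?z = "\<lambda>m. if m < s then y m else 0"
  have "A = (\<Sum>m<r. tensor_power (?z m))"
    unfolding A using s by (intro sum.mono_neutral_cong_left) (auto simp: tensor_power_zero)
  also have "\<dots> = (\<Sum>i\<in>J. tensor_power (?z (h i)))"
    by (rule sum.reindex_bij_betw[OF h, symmetric])
  finally show "\<exists>y. A = (\<Sum>i\<in>J. tensor_power (y i))"
    by (intro exI[of _ "\<lambda>i. ?z (h i)"])
next
  assume "\<exists>y. A = (\<Sum>i\<in>J. tensor_power (y i))"
  then obtain y where A: "A = (\<Sum>i\<in>J. tensor_power (y i))" ..
  obtain h where h: "bij_betw h {..<r} J"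
    using ex_bij_betw_nat_finite[OF assms(1)] assms(2) by (auto simp: atLeast0LessThan)
  have "A = (\<Sum>m<r. tensor_power (y (h m)))"
    unfolding A by (rule sum.reindex_bij_betw[OF h, symmetric])
  then have "sym_rank A \<le> enat r"
    unfolding sym_rank_def by (intro Inf_lower) auto
  moreover have "A \<in> sym_tensors"
    unfolding A by (intro sum_in_sym_tensors tensor_power_in_sym_tensors)
  ultimately show "A \<in> sym_rank_le r"
    by (simp add: sym_rank_le_def)
qed

section \<open>Limits lie in the Zariski closure\<close>

lemma tendsto_complex_polynomial:
  assumes "complex_polynomial p" and "(X \<longlongrightarrow> A) F"
  shows "((\<lambda>t. p (X t)) \<longlongrightarrow> p A) F"
  using assms(1) by induction (auto intro!: tendsto_intros assms(2))

lemma sym_tensors_limit: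
  assumes "(X \<longlongrightarrow> A) F" and "F \<noteq> bot" and "\<forall>\<^sub>F t in F. X t \<in> sym_tensors"
  shows "A \<in> sym_tensors"
proof -
  have "A $ (f \<circ> \<pi>) = A $ f" if "bij \<pi>" for f \<pi>
  proof (rule tendsto_unique[OF assms(2)])
    show "((\<lambda>t. X t $ f) \<longlongrightarrow> A $ f) F"
      by (intro tendsto_intros assms(1))
    have "\<forall>\<^sub>F t in F. X t $ (f \<circ> \<pi>) = X t $ f"
      using assms(3) by eventually_elim (use that in \<open>auto simp: sym_tensors_def\<close>)
    moreover have "((\<lambda>t. X t $ (f \<circ> \<pi>)) \<longlongrightarrow> A $ (f \<circ> \<pi>)) F"
      by (intro tendsto_intros assms(1))
    ultimately show "((\<lambda>t. X t $ f) \<longlongrightarrow> A $ (f \<circ> \<pi>)) F"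
      by (rule Lim_transform_eventually[rotated])
  qed
  then show ?thesis
    by (simp add: sym_tensors_def)
qed

text \<open>
  A polynomial that vanishes on \<open>Y\<close> is continuous, so it vanishes at the Euclidean limits of \<open>Y\<close>.
\<close>

lemma limit_in_zariski_closure:
  assumes lim: "(X \<longlongrightarrow> A) F" and F: "F \<noteq> bot"
    and Y: "\<forall>\<^sub>F t in F. X t \<in> Y" and "Y \<subseteq> sym_tensors"
  shows "A \<in> zariski_closure_in sym_tensors Y"
  unfolding zariski_closure_in_def hull_def
proof (intro InterI, clarify)
  fix Z assume "zariski_closed_in sym_tensors Z" and YZ: "Y \<subseteq> Z"
  then obtain P where P: "\<forall>p\<in>P. complex_polynomial p"
    and Z: "Z = {x \<in> sym_tensors. \<forall>p\<in>P. p x = 0}"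
    unfolding zariski_closed_in_def by blast
  have "p A = 0" if "p \<in> P" for p
  proof (rule tendsto_unique[OF F])
    show "((\<lambda>t. p (X t)) \<longlongrightarrow> p A) F"
      using P that lim by (blast intro: tendsto_complex_polynomial)
    show "((\<lambda>t. p (X t)) \<longlongrightarrow> 0) F"
      using Y by (intro tendsto_eventually, eventually_elim) (use YZ Z that in auto)
  qed
  moreover have "A \<in> sym_tensors"
    using Y assms(4) by (intro sym_tensors_limit[OF lim F]) (auto elim: eventually_mono)
  ultimately show "A \<in> Z"
    using Z by blast
qed

section \<open>Tangents to the powers\<close>

text \<open>
  Up to a scalar, this is the symmetrization of \<open>x\<^bsup>k-1\<^esup> \<otimes> y\<close>.
\<close>

definition tangent_power :: "complex ^ 'n \<Rightarrow> complex ^ 'n \<Rightarrow> ('k::finite, 'n::finite) tensor" where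
  "tangent_power x y = (\<chi> f. \<Sum>j\<in>UNIV. y $ f j * (\<Prod>l\<in>UNIV - {j}. x $ f l))"

lemma tendsto_tangent_power:
  "((\<lambda>t. (1 / t) *s (tensor_power (x + t *s y) - tensor_power x))
    \<longlongrightarrow> (tangent_power x y :: ('k::finite, 'n::finite) tensor)) (at 0)"
proof (rule vec_tendstoI)
  fix f :: "'k \<Rightarrow> 'n"
  let ?g = "\<lambda>t. \<Prod>j\<in>UNIV. x $ f j + t * y $ f j"
  have "(?g has_field_derivative (\<Sum>j\<in>UNIV. y $ f j * (\<Prod>l\<in>UNIV - {j}. x $ f l + 0 * y $ f l))) (at 0)"
    by (rule has_field_derivative_prod) (auto intro!: derivative_eq_intros)
  then have "((\<lambda>t. (?g (0 + t) - ?g 0) / t) \<longlongrightarrow> tangent_power x y $ f) (at 0)"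
    by (simp add: DERIV_def tangent_power_def)
  then show "((\<lambda>t. ((1 / t) *s (tensor_power (x + t *s y) - tensor_power x)) $ f)
      \<longlongrightarrow> tangent_power x y $ f) (at 0)"
    by (simp add: tensor_power_def diff_divide_distrib)
qed

lemma tensor_power_axis:
  "tensor_power (axis i 1) $ f = (if f = (\<lambda>_. i) then 1 else 0)"
  by (auto simp: tensor_power_def axis_def fun_eq_iff intro: prod_zero)

lemma tangent_power_axis:
  fixes f :: "'k::finite \<Rightarrow> 'n::finite"
  assumes "a \<noteq> b"
  shows "tangent_power (axis a 1) (axis b 1) $ f = (if \<exists>j. f = (\<lambda>_. a)(j := b) then 1 else 0)"
proof -
  have term_j: "axis b 1 $ f j * (\<Prod>l\<in>UNIV - {j}. axis a 1 $ f l)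
      = (if f = (\<lambda>_. a)(j := b) then 1 else (0::complex))" for j
    by (auto simp: axis_def fun_eq_iff intro: prod_zero)
  show ?thesis
  proof (cases "\<exists>j. f = (\<lambda>_. a)(j := b)")
    case True
    then obtain j where j: "f = (\<lambda>_. a)(j := b)" ..
    have "f = (\<lambda>_. a)(i := b) \<longleftrightarrow> i = j" for i
      using assms j by (auto simp: fun_eq_iff)
    then show ?thesis
      using True by (simp add: tangent_power_def term_j)
  next
    case False
    then show ?thesis
      by (simp add: tangent_power_def term_j)
  qed
qed

definition tangent_plus_powers ::
    "'n set \<Rightarrow> 'n \<Rightarrow> 'n \<Rightarrow> ('k::finite, 'n::finite) tensor" where
  "tangent_plus_powers J a b =
     tangent_power (axis a 1) (axis b 1) + (\<Sum>i\<in>J - {a, b}. tensor_power (axis i 1))"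

lemma tangent_plus_powers_nth:
  assumes "a \<noteq> b"
  shows "tangent_plus_powers J a b $ f =
    (if \<exists>j. f = (\<lambda>_. a)(j := b) then 1 else 0) + (if \<exists>i\<in>J - {a, b}. f = (\<lambda>_. i) then 1 else 0)"
proof -
  have "(\<Sum>i\<in>J - {a, b}. if f = (\<lambda>_. i) then 1 else (0::complex))
      = (if \<exists>i\<in>J - {a, b}. f = (\<lambda>_. i) then 1 else 0)"
  proof (cases "\<exists>i\<in>J - {a, b}. f = (\<lambda>_. i)")
    case True
    then obtain i where i: "i \<in> J - {a, b}" "f = (\<lambda>_. i)" by blast
    then have "f = (\<lambda>_. m) \<longleftrightarrow> m = i" for m
      by (auto simp: fun_eq_iff)
    with i True show ?thesis
      by simp
  qed (auto intro!: sum.neutral)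
  then show ?thesis
    by (simp add: tangent_plus_powers_def tangent_power_axis[OF assms] tensor_power_axis)
qed

text \<open>
  The difference quotient costs two powers, as many as the two basis vectors that the remaining sum
  leaves out; over \<open>\<complex>\<close> its scalar coefficients are absorbed into the vectors.
\<close>

lemma tangent_plus_powers_in_closure:
  fixes a b :: "'n::finite"
  assumes "a \<in> J" "b \<in> J" "a \<noteq> b"
  shows "(tangent_plus_powers J a b :: ('k::finite, 'n) tensor)
    \<in> zariski_closure_in sym_tensors (sym_rank_le (card J))"
proof (rule limit_in_zariski_closure)
  let ?S = "\<Sum>i\<in>J - {a, b}. (tensor_power (axis i 1) :: ('k, 'n) tensor)"
  let ?X = "\<lambda>t. (1 / t) *s (tensor_power (axis a 1 + t *s axis b 1) - tensor_power (axis a 1)) + ?S"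
  show "(?X \<longlongrightarrow> tangent_plus_powers J a b) (at 0)"
    unfolding tangent_plus_powers_def by (intro tendsto_add tendsto_tangent_power tendsto_const)
  show "at (0::complex) \<noteq> bot"
    by simp
  show "sym_rank_le (card J) \<subseteq> (sym_tensors :: ('k, 'n) tensor set)"
    by (auto simp: sym_rank_le_def)
  have "?X t \<in> sym_rank_le (card J)" for t
  proof -
    obtain u where u: "tensor_power u
        = (1 / t) *s (tensor_power (axis a 1 + t *s axis b 1) :: ('k, 'n) tensor)"
      using scaled_tensor_power_is_tensor_power by blast
    obtain v where v: "tensor_power v = (- 1 / t) *s (tensor_power (axis a 1) :: ('k, 'n) tensor)"
      using scaled_tensor_power_is_tensor_power by blast
    let ?y = "\<lambda>i. if i = a then u else if i = b then v else axis i 1"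
    have "(\<Sum>i\<in>J. tensor_power (?y i))
        = (\<Sum>i\<in>{a, b}. tensor_power (?y i)) + (\<Sum>i\<in>J - {a, b}. tensor_power (?y i))"
      by (subst add.commute, intro sum.subset_diff) (use assms in auto)
    also have "(\<Sum>i\<in>J - {a, b}. tensor_power (?y i)) = ?S"
      by (intro sum.cong) auto
    also have "(\<Sum>i\<in>{a, b}. tensor_power (?y i)) + ?S = ?X t"
      using assms(3) by (simp add: u v vec_eq_iff field_simps diff_divide_distrib)
    finally show ?thesis
      by (subst sym_rank_le_iff[of J]) (auto intro: exI[of _ ?y])
  qed
  then show "\<forall>\<^sub>F t in at 0. ?X t \<in> sym_rank_le (card J)"
    by simp
qed

section \<open>Slices and the rank of the limit\<close>

lemma tensor_power_fun_upd:
  "tensor_power y $ (f(p := x)) = (\<Prod>j\<in>UNIV - {p}. y $ f j) * y $ x"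
  by (simp add: tensor_power_def prod.remove[of UNIV p] mult.commute)

text \<open>
  The slices in direction \<open>p\<close> lie in the span of the \<open>y i\<close>, so by \<open>concise\<close> these vectors, as many
  as the dimension, form a basis. The products in the conclusion are the coefficients, in
  this basis, of the slice that vanishes.
\<close>

lemma vanishing_slice:
  fixes T :: "('k::finite, 'n::finite) tensor" and y :: "'n \<Rightarrow> complex ^ 'n"
  assumes T: "T = (\<Sum>i\<in>UNIV. tensor_power (y i))"
    and concise: "\<And>m. \<exists>g. \<forall>x. T $ (g(p := x)) = (if x = m then 1 else 0)"
    and zero: "\<And>x. T $ (f(p := x)) = 0"
  shows "(\<Prod>j\<in>UNIV - {p}. y i $ f j) = 0"
proof -
  obtain g where g: "\<And>m x. T $ ((g m)(p := x)) = (if x = m then 1 else 0)"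
    using concise by metis
  \<comment> \<open>Row \<open>m\<close> of \<open>C\<close> expresses the basis vector \<open>m\<close> through the rows of \<open>Y\<close>.\<close>
  define C :: "complex ^ 'n ^ 'n" where "C = (\<chi> m i. \<Prod>j\<in>UNIV - {p}. y i $ g m j)"
  define Y :: "complex ^ 'n ^ 'n" where "Y = (\<chi> i. y i)"
  define c :: "complex ^ 'n" where "c = (\<chi> i. \<Prod>j\<in>UNIV - {p}. y i $ f j)"
  have "C ** Y = mat 1"
    using g by (auto simp: vec_eq_iff matrix_matrix_mult_def mat_def C_def Y_def T
        tensor_power_fun_upd)
  then have inverse: "Y ** C = mat 1"
    by (simp add: matrix_left_right_inverse)
  have "c v* Y = 0"
    using zero by (simp add: vec_eq_iff vector_matrix_mult_def c_def Y_def T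
        tensor_power_fun_upd mult.commute)
  then have "c = 0"
    by (metis inverse vector_matrix_mul_assoc vector_matrix_mul_rid vector_matrix_mult_0)
  then show ?thesis
    by (simp add: c_def vec_eq_iff)
qed

text \<open>
  Order at least three enters through the vanishing slice: the two fixed slots \<open>q\<close> and \<open>s\<close> both carry
  \<open>b\<close>, one more than the derivative allows. In order two the statement fails, as the tensor is then
  a symmetric matrix of full rank, hence a sum of \<open>n\<close> squares.
\<close>

lemma tangent_plus_powers_not_sum:
  fixes a b :: "'n::finite" and y :: "'n \<Rightarrow> complex ^ 'n"
  assumes ab: "a \<noteq> b" and k: "2 < CARD('k::finite)"
  shows "(tangent_plus_powers UNIV a b :: ('k, 'n) tensor) \<noteq> (\<Sum>i\<in>UNIV. tensor_power (y i))"
proof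
  let ?T = "tangent_plus_powers UNIV a b :: ('k, 'n) tensor"
  assume T: "?T = (\<Sum>i\<in>UNIV. tensor_power (y i))"
  obtain K :: "'k set" where "card K = 3"
    using k obtain_subset_with_card_n[of 3 "UNIV :: 'k set"] by (metis Suc_leI numeral_3_eq_3 numeral_2_eq_2)
  then obtain p q s :: 'k where pqs: "p \<noteq> q" "p \<noteq> s" "q \<noteq> s"
    by (auto simp: card_3_iff)
  note T_nth = tangent_plus_powers_nth[OF ab]
  have concise: "\<exists>g. \<forall>x. ?T $ (g(p := x)) = (if x = m then 1 else 0)" for m
  proof -
    consider "m = a" | "m = b" | "m \<noteq> a" "m \<noteq> b" by blast
    then show ?thesis
    proof cases
      case 1
      \<comment> \<open>Slot \<open>q\<close> uses up the one \<open>b\<close>, so slot \<open>p\<close> must carry \<open>a\<close>.\<close>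
      have "?T $ (((\<lambda>_. a)(q := b))(p := x)) = (if x = m then 1 else 0)" for x
      proof -
        have "(\<exists>j. ((\<lambda>_. a)(q := b))(p := x) = (\<lambda>_. a)(j := b)) \<longleftrightarrow> x = a"
          using ab pqs by (metis fun_upd_apply fun_upd_triv)
        moreover have "((\<lambda>_. a)(q := b))(p := x) \<noteq> (\<lambda>_. i)" if "i \<in> UNIV - {a, b}" for i
          using that pqs by (metis DiffE fun_upd_apply insertCI)
        ultimately show ?thesis
          using 1 by (auto simp: T_nth)
      qed
      then show ?thesis by blast
    next
      case 2
      \<comment> \<open>The one \<open>b\<close> is still missing, so slot \<open>p\<close> must carry it.\<close>
      have "?T $ ((\<lambda>_. a)(p := x)) = (if x = m then 1 else 0)" for x
      proof -
        have "(\<exists>j. (\<lambda>_. a)(p := x) = (\<lambda>_. a)(j := b)) \<longleftrightarrow> x = b"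
          using ab by (metis fun_upd_apply)
        moreover have "(\<lambda>_. a)(p := x) \<noteq> (\<lambda>_. i)" if "i \<in> UNIV - {a, b}" for i
          using that pqs by (metis DiffE fun_upd_apply insertCI)
        ultimately show ?thesis
          using 2 by (auto simp: T_nth)
      qed
      then show ?thesis by blast
    next
      case 3
      have "?T $ ((\<lambda>_. m)(p := x)) = (if x = m then 1 else 0)" for x
      proof -
        have "\<not> (\<exists>j. (\<lambda>_. m)(p := x) = (\<lambda>_. a)(j := b))"
          using 3 pqs by (metis fun_upd_apply)
        moreover have "(\<exists>i\<in>UNIV - {a, b}. (\<lambda>_. m)(p := x) = (\<lambda>_. i)) \<longleftrightarrow> x = m"
          using 3 pqs by (metis DiffI UNIV_I fun_upd_apply fun_upd_triv insertE singletonD)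
        ultimately show ?thesis
          by (simp add: T_nth)
      qed
      then show ?thesis by blast
    qed
  qed
  have zero: "?T $ ((\<lambda>_. b)(p := x)) = 0" for x
  proof -
    have "(\<lambda>_. b)(p := x) \<noteq> (\<lambda>_. a)(j := b)" for j
      using ab pqs by (metis fun_upd_apply)
    moreover have "(\<lambda>_. b)(p := x) \<noteq> (\<lambda>_. i)" if "i \<in> UNIV - {a, b}" for i
      using that pqs by (metis DiffE fun_upd_apply insertCI)
    ultimately show ?thesis
      by (auto simp: T_nth)
  qed
  have y_b: "y i $ b = 0" for i
    using vanishing_slice[OF T concise zero, of i] by simp
  have "?T $ ((\<lambda>_. a)(p := b)) = 1"
    using ab by (auto simp: T_nth fun_eq_iff)
  moreover have "?T $ ((\<lambda>_. a)(p := b)) = 0"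
    by (simp add: T tensor_power_fun_upd y_b)
  ultimately show False
    by simp
qed

text \<open>
  The powers of the basis vectors outside \<open>J\<close> turn the tensor into the one for the full index set and a
  decomposition over \<open>J\<close> into one over the full index set.
\<close>

lemma tangent_plus_powers_not_in_sym_rank_le:
  fixes a b :: "'n::finite"
  assumes "a \<in> J" "b \<in> J" "a \<noteq> b" "2 < CARD('k::finite)"
  shows "(tangent_plus_powers J a b :: ('k, 'n) tensor) \<notin> sym_rank_le (card J)"
proof
  assume "(tangent_plus_powers J a b :: ('k, 'n) tensor) \<in> sym_rank_le (card J)"
  then obtain y where y: "(tangent_plus_powers J a b :: ('k, 'n) tensor) = (\<Sum>i\<in>J. tensor_power (y i))"
    by (subst (asm) sym_rank_le_iff[of J]) auto
  let ?z = "\<lambda>i. if i \<in> J then y i else axis i 1"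
  have split: "UNIV - {a, b} = (J - {a, b}) \<union> - J"
    using assms by auto
  have "(tangent_plus_powers UNIV a b :: ('k, 'n) tensor)
      = tangent_plus_powers J a b + (\<Sum>i\<in>- J. tensor_power (axis i 1))"
    unfolding tangent_plus_powers_def split by (subst sum.union_disjoint) auto
  also have "\<dots> = (\<Sum>i\<in>J. tensor_power (?z i)) + (\<Sum>i\<in>- J. tensor_power (?z i))"
    unfolding y by (intro arg_cong2[of _ _ _ _ "(+)"] sum.cong) auto
  also have "\<dots> = (\<Sum>i\<in>UNIV. tensor_power (?z i))"
    by (subst sum.union_disjoint[symmetric]) auto
  finally show False
    using tangent_plus_powers_not_sum[OF assms(3,4), of ?z] by contradiction
qed

theorem proposition6p9:
  fixes r :: nat
  assumes "1 < r" and "r \<le> CARD('n::finite)" and "2 < CARD('k::finite)"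
  shows "(sym_rank_le r :: ('k, 'n) tensor set) \<noteq>
         zariski_closure_in (sym_tensors :: ('k, 'n) tensor set) (sym_rank_le r)"
proof -
  obtain J :: "'n set" where J: "card J = r"
    using assms(2) obtain_subset_with_card_n by metis
  then obtain a b where "a \<in> J" "b \<in> J" "a \<noteq> b"
    using assms(1) by (metis One_nat_def card_le_Suc0_iff_eq finite linorder_not_less)
  then show ?thesis
    using tangent_plus_powers_in_closure[of a J b] J
      tangent_plus_powers_not_in_sym_rank_le[of a J b, OF _ _ _ assms(3)]
    by metis
qed

end
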